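(* Let $X$ be a Banach space with property ( * ). Then $X$ is weakly sequentially complete.
   Context: Banach spaces are real. For $\varepsilon\ge 0$, a bounded subset $M$ of a Banach space $X$ is $\varepsilon$-weakly relatively compact if $\overline{M}^{w^*}\subseteq X+\varepsilon B_{X^{**}}$, where the closure is taken in $(X^{**},w^* )$. A Banach space $X$ has property ( * ) if there is a countable family $\{M_{n,p}: n,p\in\mathbb{N}\}$ of (convex and symmetric) subsets of $X$ such that (i) for all $n,p\in\mathbb{N}$ the set $M_{n,p}$ is $\frac1p$-weakly relatively compact; (ii) for every $p\in\mathbb{N}$ and every weakly compact subset $L$ of $X$ there is $n\in\mathbb{N}$ with $L\subseteq M_{n,p}$. $X$ is weakly sequentially complete if every weakly Cauchy sequence in $X$ converges weakly to an element of $X$. *)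

theory Defs
  imports "HOL-Analysis.Analysis"
begin

type_synonym 'a dual = "'a \<Rightarrow>\<^sub>L real"
type_synonym 'a bidual = "'a dual \<Rightarrow>\<^sub>L real"

lift_definition canonical_embedding :: "'a::real_normed_vector \<Rightarrow> 'a bidual"
  is "\<lambda>x f. blinfun_apply f x"
  by (rule blinfun.bounded_linear_left)

text \<open>
  The right-hand \<open>euclidean\<close> is the product topology on \<open>'a dual \<Rightarrow> real\<close>, so this is the
  coarsest topology on \<open>'a\<close> that makes every bounded functional continuous.
\<close>

definition weak_topology :: "'a::real_normed_vector topology" where
  "weak_topology = pullback_topology UNIV (\<lambda>x (f :: 'a dual). blinfun_apply f x) euclidean"

text \<open>
  For real-valued functionals the strong operator topology is the topology of pointwise
  convergence, which is the weak* topology of a dual space; here the dual space is the bidual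
  of \<open>'a\<close>.
\<close>

abbreviation weak_star_topology :: "'a::real_normed_vector bidual topology" where
  "weak_star_topology \<equiv> strong_operator_topology"

definition eps_weakly_relatively_compact :: "real \<Rightarrow> 'a::real_normed_vector set \<Rightarrow> bool" where
  "eps_weakly_relatively_compact \<epsilon> M \<longleftrightarrow>
     bounded M \<and>
     weak_star_topology closure_of (canonical_embedding ` M)
       \<subseteq> {canonical_embedding x + \<epsilon> *\<^sub>R u | x u. u \<in> cball 0 1}"

text \<open>
  The second index starts at \<open>1\<close>, since \<open>1 / 0 = 0\<close> in HOL would make the condition for
  \<open>p = 0\<close> one of weak relative compactness. The first index is only a label.
\<close>

definition has_property_star :: "'a::banach itself \<Rightarrow> bool" where
  "has_property_star _ \<longleftrightarrow>
     (\<exists>M :: nat \<Rightarrow> nat \<Rightarrow> 'a set.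
        (\<forall>n. \<forall>p\<ge>1. convex (M n p) \<and> (\<forall>x\<in>M n p. - x \<in> M n p)) \<and>
        (\<forall>n. \<forall>p\<ge>1. eps_weakly_relatively_compact (1 / real p) (M n p)) \<and>
        (\<forall>p\<ge>1. \<forall>L. compactin weak_topology L \<longrightarrow> (\<exists>n. L \<subseteq> M n p)))"

definition weakly_Cauchy :: "(nat \<Rightarrow> 'a::real_normed_vector) \<Rightarrow> bool" where
  "weakly_Cauchy x \<longleftrightarrow> (\<forall>f :: 'a dual. Cauchy (\<lambda>n. blinfun_apply f (x n)))"

definition weakly_sequentially_complete :: "'a::banach itself \<Rightarrow> bool" where
  "weakly_sequentially_complete _ \<longleftrightarrow>
     (\<forall>x :: nat \<Rightarrow> 'a. weakly_Cauchy x \<longrightarrow> (\<exists>l. limitin weak_topology x l sequentially))"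

lemma topspace_weak_topology [simp]: "topspace weak_topology = UNIV"
  by (simp add: weak_topology_def topspace_pullback_topology)

lemma limitin_weak_topology_iff:
  fixes x :: "'b \<Rightarrow> 'a::real_normed_vector"
  shows "limitin weak_topology x l F \<longleftrightarrow>
    (\<forall>f :: 'a dual. ((\<lambda>n. blinfun_apply f (x n)) \<longlongrightarrow> blinfun_apply f l) F)"
proof -
  let ?e = "\<lambda>y (f :: 'a dual). blinfun_apply f y"
  have "limitin weak_topology x l F \<longleftrightarrow> limitin euclidean (\<lambda>n. ?e (x n)) (?e l) F"
    unfolding limitin_def weak_topology_def
    by (auto simp: openin_pullback_topology topspace_pullback_topology)
  also have "\<dots> \<longleftrightarrow> (\<forall>f. limitin euclidean (\<lambda>n. ?e (x n) f) (?e l f) F)"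
    unfolding euclidean_product_topology [symmetric] limitin_componentwise by auto
  finally show ?thesis
    by simp
qed

end

theory Submission
  imports Defs
begin

text \<open>
  Fix \<open>p\<close>, and let \<open>x\<close> be weakly Cauchy with weak* limit \<open>\<xi>\<close> in the bidual. If for every \<open>k\<close>
  some difference \<open>z k = x i - x j\<close> with \<open>i, j \<ge> k\<close> were outside \<open>M k p\<close>, then \<open>z\<close> would be
  weakly null and the weakly compact set \<open>{0} \<union> {z k | k}\<close> would lie in no \<open>M n p\<close>. So some
  \<open>M k p\<close> contains all \<open>x i - x j\<close> with \<open>i, j \<ge> k\<close>; hence \<open>\<xi> - x k\<close> is in its weak* closure
  and \<open>\<xi>\<close> has distance at most \<open>1 / p\<close> from \<open>X\<close>. As \<open>p\<close> is arbitrary and \<open>X\<close> is norm closed in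
  its bidual, \<open>\<xi>\<close> belongs to \<open>X\<close>. The closedness uses that the canonical embedding is isometric,
  for which the Hahn-Banach theorem is derived from the linearity of minimal sublinear functionals.
\<close>

section \<open>Sublinear functionals and the Hahn-Banach theorem\<close>

definition sublinear :: "('a::real_vector \<Rightarrow> real) \<Rightarrow> bool" where
  "sublinear q \<longleftrightarrow>
     (\<forall>x y. q (x + y) \<le> q x + q y) \<and> (\<forall>c\<ge>0. \<forall>x. q (c *\<^sub>R x) \<le> c * q x)"

lemma sublinearI:
  assumes "\<And>x y. q (x + y) \<le> q x + q y" and "\<And>c x. c \<ge> 0 \<Longrightarrow> q (c *\<^sub>R x) \<le> c * q x"
  shows "sublinear q"
  using assms by (simp add: sublinear_def)

lemma sublinear_add: "sublinear q \<Longrightarrow> q (x + y) \<le> q x + q y"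
  and sublinear_scaleR_le: "sublinear q \<Longrightarrow> c \<ge> 0 \<Longrightarrow> q (c *\<^sub>R x) \<le> c * q x"
  by (simp_all add: sublinear_def)

lemma sublinear_zero: "sublinear q \<Longrightarrow> q 0 = 0"
  using sublinear_add [of q 0 0] sublinear_scaleR_le [of q 0 0] by simp

text \<open>Scaling \<open>c *\<^sub>R x\<close> back by \<open>inverse c\<close> reverses the
  inequality, so the one-sided condition in \<open>sublinear\<close> already gives positive
  homogeneity.\<close>

lemma sublinear_scaleR:
  assumes "sublinear q" "c \<ge> 0"
  shows "q (c *\<^sub>R x) = c * q x"
proof (cases "c = 0")
  case True
  then show ?thesis
    using sublinear_zero [OF assms(1)] by simp
next
  case False
  then have "c > 0"
    using assms by simp
  then have "c * q x \<le> q (c *\<^sub>R x)"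
    using sublinear_scaleR_le [OF assms(1), of "inverse c" "c *\<^sub>R x"] by (simp add: field_simps)
  with sublinear_scaleR_le [OF assms] show ?thesis
    by (simp add: antisym)
qed

lemma sublinear_minus_le: "sublinear q \<Longrightarrow> - q (- x) \<le> q x"
  using sublinear_add [of q x "- x"] sublinear_zero [of q] by simp

lemma sublinear_norm: "sublinear norm"
  by (simp add: sublinear_def norm_triangle_ineq)

text \<open>For sublinear \<open>q\<close> this is the largest sublinear \<open>r \<le> q\<close>
  with \<open>r (- y) \<le> - q y\<close>: such an \<open>r\<close> satisfies
  \<open>r x \<le> r (x + t *\<^sub>R y) + t * r (- y)\<close>.\<close>

definition sublinear_shift :: "('a::real_vector \<Rightarrow> real) \<Rightarrow> 'a \<Rightarrow> 'a \<Rightarrow> real" where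
  "sublinear_shift q y x = (INF t\<in>{0..}. q (x + t *\<^sub>R y) - t * q y)"

lemma sublinear_shift_le:
  assumes "sublinear q" "t \<ge> 0"
  shows "sublinear_shift q y x \<le> q (x + t *\<^sub>R y) - t * q y"
proof -
  \<comment> \<open>A lower bound independent of \<open>s\<close>; without it the real infimum would
    have no specified value.\<close>
  have "- q (- x) \<le> q (x + s *\<^sub>R y) - s * q y" if "s \<ge> 0" for s
    using sublinear_add [OF assms(1), of "x + s *\<^sub>R y" "- x"] sublinear_scaleR [OF assms(1) that, of y]
    by simp
  then have "bdd_below ((\<lambda>t. q (x + t *\<^sub>R y) - t * q y) ` {0..})"
    by (intro bdd_belowI [where m = "- q (- x)"]) auto
  then show ?thesis
    unfolding sublinear_shift_def using assms(2) by (intro cINF_lower) auto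
qed

lemma le_sublinear_shift:
  assumes "\<And>t. t \<ge> 0 \<Longrightarrow> b \<le> q (x + t *\<^sub>R y) - t * q y"
  shows "b \<le> sublinear_shift q y x"
  unfolding sublinear_shift_def using assms by (intro cINF_greatest) auto

lemma sublinear_sublinear_shift:
  assumes q: "sublinear q"
  shows "sublinear (sublinear_shift q y)"
proof (rule sublinearI)
  fix u v
  \<comment> \<open>Separate parameters \<open>s\<close> and \<open>t\<close>, joined as
    \<open>s + t\<close> on the left, let the two infima be taken one after the other.\<close>
  have "sublinear_shift q y (u + v) \<le> (q (u + s *\<^sub>R y) - s * q y) + (q (v + t *\<^sub>R y) - t * q y)"
    if "s \<ge> 0" "t \<ge> 0" for s t
    using sublinear_shift_le [OF q, of "s + t" y "u + v"] that
      sublinear_add [OF q, of "u + s *\<^sub>R y" "v + t *\<^sub>R y"]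
    by (simp add: algebra_simps)
  then have "sublinear_shift q y (u + v) - (q (v + t *\<^sub>R y) - t * q y) \<le> sublinear_shift q y u"
    if "t \<ge> 0" for t
    using that by (intro le_sublinear_shift) (simp add: diff_le_eq)
  then have "sublinear_shift q y (u + v) - sublinear_shift q y u \<le> sublinear_shift q y v"
    by (intro le_sublinear_shift) (simp add: algebra_simps)
  then show "sublinear_shift q y (u + v) \<le> sublinear_shift q y u + sublinear_shift q y v"
    by simp
next
  fix c :: real and u
  assume "c \<ge> 0"
  show "sublinear_shift q y (c *\<^sub>R u) \<le> c * sublinear_shift q y u"
  proof (cases "c = 0")
    case True
    then show ?thesis
      using sublinear_shift_le [OF q, of 0 y 0] sublinear_zero [OF q] by simp
  next
    case False
    with \<open>c \<ge> 0\<close> have "c > 0"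
      by simp
    have "sublinear_shift q y (c *\<^sub>R u) / c \<le> q (u + t *\<^sub>R y) - t * q y" if "t \<ge> 0" for t
    proof -
      have "sublinear_shift q y (c *\<^sub>R u) \<le> q (c *\<^sub>R (u + t *\<^sub>R y)) - (c * t) * q y"
        using sublinear_shift_le [OF q, of "c * t" y "c *\<^sub>R u"] that \<open>c > 0\<close>
        by (simp add: scaleR_add_right)
      also have "\<dots> = c * (q (u + t *\<^sub>R y) - t * q y)"
        by (simp add: sublinear_scaleR [OF q \<open>c \<ge> 0\<close>] right_diff_distrib)
      finally show ?thesis
        using \<open>c > 0\<close> by (simp add: divide_le_eq mult.commute)
    qed
    then have "sublinear_shift q y (c *\<^sub>R u) / c \<le> sublinear_shift q y u"
      by (rule le_sublinear_shift)
    then show ?thesis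
      using \<open>c > 0\<close> by (simp add: divide_le_eq mult.commute)
  qed
qed

lemma sublinear_shift_le_self: "sublinear q \<Longrightarrow> sublinear_shift q y \<le> q"
  using sublinear_shift_le [of q 0 y] by (simp add: le_fun_def)

lemma sublinear_shift_minus_le:
  assumes "sublinear q"
  shows "sublinear_shift q y (- y) \<le> - q y"
  using sublinear_shift_le [OF assms, of 1 y "- y"] sublinear_zero [OF assms] by simp

text \<open>Minimality makes every shift equal to \<open>q\<close>, which forces \<open>q\<close> to
  be odd. An odd subadditive function is also superadditive, and oddness extends homogeneity to
  negative scalars.\<close>

lemma minimal_sublinear_imp_linear:
  assumes q: "sublinear q" and minimal: "\<And>r. sublinear r \<Longrightarrow> r \<le> q \<Longrightarrow> r = q"
  shows "linear q"
proof -
  have minus: "q (- x) = - q x" for x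
  proof -
    have "sublinear_shift q x = q"
      by (intro minimal sublinear_sublinear_shift sublinear_shift_le_self q)
    then have "q (- x) \<le> - q x"
      using sublinear_shift_minus_le [OF q, of x] by simp
    with sublinear_minus_le [OF q, of x] show ?thesis
      by simp
  qed
  have "q x + q y \<le> q (x + y)" for x y
    using sublinear_add [OF q, of "x + y" "- y"] by (simp add: minus)
  then have "q (x + y) = q x + q y" for x y
    by (simp add: antisym sublinear_add [OF q])
  moreover have "q (c *\<^sub>R x) = c * q x" for c x
  proof (cases "c \<ge> 0")
    case True
    then show ?thesis
      by (rule sublinear_scaleR [OF q])
  next
    case False
    then have "q ((- c) *\<^sub>R x) = - c * q x"
      by (intro sublinear_scaleR [OF q]) simp
    then show ?thesis
      by (simp add: minus)
  qed
  ultimately show ?thesis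
    by (intro linearI) simp_all
qed

text \<open>Supplies the bounds of chains for Zorn's lemma. The common majorant \<open>p\<close>
  keeps the pointwise infimum finite.\<close>

lemma sublinear_INF_chain:
  fixes C :: "('a::real_vector \<Rightarrow> real) set"
  assumes "C \<noteq> {}" and subl: "\<And>r. r \<in> C \<Longrightarrow> sublinear r \<and> r \<le> p"
    and chain: "\<And>r s. r \<in> C \<Longrightarrow> s \<in> C \<Longrightarrow> r \<le> s \<or> s \<le> r"
  defines "u \<equiv> \<lambda>x. INF r\<in>C. r x"
  shows "sublinear u" and "\<And>r. r \<in> C \<Longrightarrow> u \<le> r"
proof -
  have "- p (- x) \<le> r x" if "r \<in> C" for r x
    using sublinear_minus_le [of r x] subl [OF that] le_funD [of r p "- x"] by simp
  then have bdd: "bdd_below ((\<lambda>r. r x) ` C)" for x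
    by (intro bdd_belowI [where m = "- p (- x)"]) auto
  have lower: "u x \<le> r x" if "r \<in> C" for r x
    unfolding u_def by (rule cINF_lower [OF bdd that])
  have greatest: "b \<le> u x" if "\<And>r. r \<in> C \<Longrightarrow> b \<le> r x" for b x
    unfolding u_def by (rule cINF_greatest [OF assms(1) that])
  show "u \<le> r" if "r \<in> C" for r
    using lower [OF that] by (simp add: le_fun_def)
  show "sublinear u"
  proof (rule sublinearI)
    fix x y
    \<comment> \<open>The smaller of \<open>r\<close> and \<open>s\<close> bounds both terms; this
      is where the chain condition enters.\<close>
    have add: "u (x + y) \<le> r x + s y" if "r \<in> C" "s \<in> C" for r s
    proof (cases "r \<le> s")
      case True
      then show ?thesis
        using lower [OF that(1), of "x + y"] sublinear_add [of r x y] subl [OF that(1)]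
          le_funD [OF True, of y] by simp
    next
      case False
      then have "s \<le> r"
        using chain that by blast
      then show ?thesis
        using lower [OF that(2), of "x + y"] sublinear_add [of s x y] subl [OF that(2)]
          le_funD [of s r x] by simp
    qed
    have "u (x + y) - s y \<le> u x" if "s \<in> C" for s
      by (rule greatest) (use add that in \<open>simp add: diff_le_eq\<close>)
    then have "u (x + y) - u x \<le> u y"
      by (intro greatest) (simp add: algebra_simps)
    then show "u (x + y) \<le> u x + u y"
      by simp
  next
    fix c :: real and x
    assume c: "c \<ge> 0"
    have le: "u (c *\<^sub>R x) \<le> c * r x" if "r \<in> C" for r
      using lower [OF that, of "c *\<^sub>R x"] sublinear_scaleR_le [of r c x] subl [OF that] c by simp
    show "u (c *\<^sub>R x) \<le> c * u x"
    proof (cases "c = 0")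
      case True
      then show ?thesis
        using le assms(1) by auto
    next
      case False
      with c have "c > 0"
        by simp
      then have "u (c *\<^sub>R x) / c \<le> u x"
        using le by (intro greatest) (simp add: divide_le_eq mult.commute)
      then show ?thesis
        using \<open>c > 0\<close> by (simp add: divide_le_eq mult.commute)
    qed
  qed
qed

lemma exists_linear_le_sublinear:
  fixes p :: "'a::real_vector \<Rightarrow> real"
  assumes p: "sublinear p"
  shows "\<exists>f. linear f \<and> f \<le> p"
proof -
  let ?A = "{q. sublinear q \<and> q \<le> p}"
  \<comment> \<open>The order is reversed, so that a maximal element in Zorn's lemma is a minimal
    sublinear functional.\<close>
  let ?P = "\<lambda>q r. r \<le> (q :: 'a \<Rightarrow> real)"
  have "\<exists>m\<in>?A. \<forall>a\<in>?A. ?P m a \<longrightarrow> a = m"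
  proof (rule predicate_Zorn)
    show "partial_order_on ?A (relation_of ?P ?A)"
      by (rule partial_order_on_relation_ofI) auto
  next
    fix C
    assume "C \<in> Chains (relation_of ?P ?A)"
    then have C: "\<And>r. r \<in> C \<Longrightarrow> sublinear r \<and> r \<le> p"
        and chain: "\<And>r s. r \<in> C \<Longrightarrow> s \<in> C \<Longrightarrow> r \<le> s \<or> s \<le> r"
      unfolding Chains_def relation_of_def by blast+
    show "\<exists>u\<in>?A. \<forall>a\<in>C. ?P a u"
    proof (cases "C = {}")
      case True
      then show ?thesis
        using p by auto
    next
      case False
      then obtain r where "r \<in> C"
        by blast
      define u where "u = (\<lambda>x. INF r\<in>C. r x)"
      have u: "sublinear u" "\<And>r. r \<in> C \<Longrightarrow> u \<le> r"
        unfolding u_def using sublinear_INF_chain [of C p] False C chain by blast+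
      moreover have "u \<le> p"
        using u(2) [OF \<open>r \<in> C\<close>] C [OF \<open>r \<in> C\<close>] by (meson order_trans)
      ultimately show ?thesis
        by blast
    qed
  qed
  then obtain m where "sublinear m" "m \<le> p" "\<And>r. sublinear r \<Longrightarrow> r \<le> p \<Longrightarrow> r \<le> m \<Longrightarrow> r = m"
    by blast
  then have "linear m"
    by (meson minimal_sublinear_imp_linear order_trans)
  with \<open>m \<le> p\<close> show ?thesis
    by blast
qed

text \<open>Domination by the shift of the norm along \<open>x\<close>, rather than by the norm
  itself, forces \<open>f (- x) \<le> - norm x\<close>.\<close>

lemma exists_norming_functional:
  fixes x :: "'a::real_normed_vector"
  shows "\<exists>f :: 'a dual. norm f \<le> 1 \<and> norm x \<le> blinfun_apply f x"
proof -
  obtain f where f: "linear f" "f \<le> sublinear_shift norm x"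
    using exists_linear_le_sublinear [OF sublinear_sublinear_shift [OF sublinear_norm]] by blast
  then have le: "f y \<le> norm y" for y
    using sublinear_shift_le_self [OF sublinear_norm, of x] by (meson le_funD order_trans)
  have abs: "norm (f y) \<le> norm y * 1" for y
    using le [of y] le [of "- y"] linear_neg [OF f(1), of y] by simp
  have bl: "bounded_linear f"
    using f(1) abs by (intro bounded_linear_intro [where K = 1]) (simp_all add: linear_add linear_scale)
  have "f (- x) \<le> - norm x"
    using le_funD [OF f(2), of "- x"] sublinear_shift_minus_le [OF sublinear_norm, of x] by simp
  then have "norm x \<le> f x"
    using linear_neg [OF f(1), of x] by simp
  moreover have "norm (Blinfun f) \<le> 1"
    using abs by (intro norm_blinfun_bound) (simp_all add: bounded_linear_Blinfun_apply [OF bl])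
  ultimately show ?thesis
    using bounded_linear_Blinfun_apply [OF bl] by (intro exI [of _ "Blinfun f"]) simp
qed

section \<open>The canonical embedding into the bidual\<close>

lemma canonical_embedding_apply [simp]:
  "blinfun_apply (canonical_embedding x) f = blinfun_apply f x"
  by transfer simp

lemma bounded_linear_canonical_embedding:
  "bounded_linear (canonical_embedding :: 'a::real_normed_vector \<Rightarrow> _)"
proof (rule bounded_linear_intro [where K = 1])
  fix x y :: 'a and c :: real
  show "canonical_embedding (x + y) = canonical_embedding x + canonical_embedding y"
    by (rule blinfun_eqI) (simp add: blinfun.bilinear_simps)
  show "canonical_embedding (c *\<^sub>R x) = c *\<^sub>R canonical_embedding x"
    by (rule blinfun_eqI) (simp add: blinfun.bilinear_simps)
  have "norm (blinfun_apply f x) \<le> norm x * norm f" for f :: "'a dual"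
    using norm_blinfun [of f x] by (simp add: mult.commute)
  then have "norm (canonical_embedding x) \<le> norm x"
    by (intro norm_blinfun_bound) simp_all
  then show "norm (canonical_embedding x) \<le> norm x * 1"
    by simp
qed

lemma norm_canonical_embedding_ge: "norm x \<le> norm (canonical_embedding x)"
proof -
  obtain f :: "'a dual" where f: "norm f \<le> 1" "norm x \<le> blinfun_apply f x"
    using exists_norming_functional by blast
  have "norm x \<le> norm (blinfun_apply (canonical_embedding x) f)"
    using f(2) by simp
  also have "\<dots> \<le> norm (canonical_embedding x) * norm f"
    by (rule norm_blinfun)
  also have "\<dots> \<le> norm (canonical_embedding x)"
    using f(1) by (simp add: mult_left_le)
  finally show ?thesis .
qed

text \<open>The lower norm estimate carries completeness of the space over to its image, and
  complete sets are closed.\<close>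

lemma closed_range_canonical_embedding:
  "closed (range (canonical_embedding :: 'a::banach \<Rightarrow> _))"
proof (rule complete_imp_closed, rule complete_isometric_image [where e = 1])
  show "complete (UNIV :: 'a set)"
    by (rule complete_UNIV)
qed (simp_all add: bounded_linear_canonical_embedding norm_canonical_embedding_ge)

section \<open>Weakly Cauchy sequences and their weak* limits\<close>

lemma limitin_strong_operator_topology_iff:
  "limitin strong_operator_topology \<phi> l F \<longleftrightarrow>
    (\<forall>x. ((\<lambda>n. blinfun_apply (\<phi> n) x) \<longlongrightarrow> blinfun_apply l x) F)"
proof -
  have "limitin strong_operator_topology \<phi> l F \<longleftrightarrow>
      limitin euclidean (\<lambda>n. blinfun_apply (\<phi> n)) (blinfun_apply l) F"
    unfolding limitin_def strong_operator_topology_def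
    by (auto simp: openin_pullback_topology topspace_pullback_topology)
  also have "\<dots> \<longleftrightarrow> (\<forall>x. limitin euclidean (\<lambda>n. blinfun_apply (\<phi> n) x) (blinfun_apply l x) F)"
    unfolding euclidean_product_topology [symmetric] limitin_componentwise by auto
  finally show ?thesis
    by simp
qed

text \<open>Both index maps tend to infinity, so along each of them the values of \<open>f\<close>
  have the same limit.\<close>

lemma weakly_Cauchy_diff_tendsto_0:
  fixes f :: "'a::real_normed_vector dual"
  assumes "weakly_Cauchy x" and "\<And>k. i k \<ge> k" "\<And>k. j k \<ge> k"
  shows "(\<lambda>k. blinfun_apply f (x (i k) - x (j k))) \<longlonglongrightarrow> 0"
proof -
  have "convergent (\<lambda>n. blinfun_apply f (x n))"
    using assms(1) by (simp add: weakly_Cauchy_def Cauchy_convergent_iff)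
  then obtain l where l: "(\<lambda>n. blinfun_apply f (x n)) \<longlonglongrightarrow> l"
    by (auto simp: convergent_def)
  have "filterlim i sequentially sequentially" "filterlim j sequentially sequentially"
    using assms(2,3) by (auto intro: filterlim_at_top_mono [OF filterlim_ident])
  then have "(\<lambda>k. blinfun_apply f (x (i k))) \<longlonglongrightarrow> l" "(\<lambda>k. blinfun_apply f (x (j k))) \<longlonglongrightarrow> l"
    by (auto intro: filterlim_compose [OF l])
  from tendsto_diff [OF this] show ?thesis
    by (simp add: blinfun.diff_right)
qed

lemma weakly_Cauchy_differences_in_countable_cover:
  assumes x: "weakly_Cauchy x"
    and cover: "\<And>L. compactin weak_topology L \<Longrightarrow> \<exists>n. L \<subseteq> N n"
  shows "\<exists>k. \<forall>i\<ge>k. \<forall>j\<ge>k. x i - x j \<in> N k"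
proof (rule ccontr)
  assume "\<not> ?thesis"
  \<comment> \<open>The same \<open>k\<close> bounds the indices from below and names the set to be
    avoided, so a single weakly null sequence escapes every \<open>N k\<close>.\<close>
  then have "\<forall>k. \<exists>i j. i \<ge> k \<and> j \<ge> k \<and> x i - x j \<notin> N k"
    by blast
  then obtain i j where ij: "\<And>k. i k \<ge> k" "\<And>k. j k \<ge> k" "\<And>k. x (i k) - x (j k) \<notin> N k"
    by metis
  have "limitin weak_topology (\<lambda>k. x (i k) - x (j k)) 0 sequentially"
    using weakly_Cauchy_diff_tendsto_0 [OF x ij(1,2)]
    by (simp add: limitin_weak_topology_iff)
  then have "compactin weak_topology (insert 0 (range (\<lambda>k. x (i k) - x (j k))))"
    by (rule compactin_sequence_with_limit) auto
  then obtain n where "insert 0 (range (\<lambda>k. x (i k) - x (j k))) \<subseteq> N n"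
    using cover by blast
  with ij(3) [of n] show False
    by blast
qed

text \<open>Limits of functionals along \<open>x\<close> depend linearly on the functional, and
  \<open>B\<close> bounds the norm of the resulting map. A bound on a tail suffices for the
  limit.\<close>

lemma weakly_Cauchy_bidual_limit:
  fixes x :: "nat \<Rightarrow> 'a::real_normed_vector"
  assumes x: "weakly_Cauchy x" and bdd: "\<And>n. n \<ge> k \<Longrightarrow> norm (x n) \<le> B"
  shows "\<exists>\<xi> :: 'a bidual. \<forall>f. (\<lambda>n. blinfun_apply f (x n)) \<longlonglongrightarrow> blinfun_apply \<xi> f"
proof -
  have "\<exists>l. (\<lambda>n. blinfun_apply f (x n)) \<longlonglongrightarrow> l" for f :: "'a dual"
    using x by (simp add: weakly_Cauchy_def Cauchy_convergent_iff convergent_def)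
  then obtain \<phi> where \<phi>: "\<And>f :: 'a dual. (\<lambda>n. blinfun_apply f (x n)) \<longlonglongrightarrow> \<phi> f"
    by metis
  have "bounded_linear \<phi>"
  proof (rule bounded_linear_intro [where K = B])
    fix f g :: "'a dual" and c :: real
    have "(\<lambda>n. blinfun_apply (f + g) (x n)) \<longlonglongrightarrow> \<phi> f + \<phi> g"
      using tendsto_add [OF \<phi> [of f] \<phi> [of g]] by (simp add: blinfun.add_left)
    then show "\<phi> (f + g) = \<phi> f + \<phi> g"
      using LIMSEQ_unique \<phi> by blast
    have "(\<lambda>n. blinfun_apply (c *\<^sub>R f) (x n)) \<longlonglongrightarrow> c *\<^sub>R \<phi> f"
      using tendsto_scaleR [OF tendsto_const \<phi> [of f], of c] by (simp add: blinfun.scaleR_left)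
    then show "\<phi> (c *\<^sub>R f) = c *\<^sub>R \<phi> f"
      using LIMSEQ_unique \<phi> by blast
    have "norm (blinfun_apply f (x n)) \<le> norm f * B" if "n \<ge> k" for n
      using norm_blinfun [of f "x n"] mult_left_mono [OF bdd [OF that], of "norm f"] by simp
    then show "norm (\<phi> f) \<le> norm f * B"
      by (intro Lim_bounded [OF tendsto_norm [OF \<phi>], of k]) simp
  qed
  then show ?thesis
    using \<phi> by (intro exI [of _ "Blinfun \<phi>"]) (simp add: bounded_linear_Blinfun_apply)
qed

theorem theorem2p20:
  assumes "has_property_star TYPE('a::banach)"
  shows "weakly_sequentially_complete TYPE('a)"
  unfolding weakly_sequentially_complete_def
proof (intro allI impI)
  fix x :: "nat \<Rightarrow> 'a"
  assume x: "weakly_Cauchy x"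
  let ?J = "canonical_embedding :: 'a \<Rightarrow> 'a bidual"
  obtain M :: "nat \<Rightarrow> nat \<Rightarrow> 'a set" where
    rel: "\<And>n p. p \<ge> 1 \<Longrightarrow> eps_weakly_relatively_compact (1 / real p) (M n p)" and
    cover: "\<And>p L. p \<ge> 1 \<Longrightarrow> compactin weak_topology L \<Longrightarrow> \<exists>n. L \<subseteq> M n p"
    using assms unfolding has_property_star_def by metis
  have tail: "\<exists>k. \<forall>i\<ge>k. \<forall>j\<ge>k. x i - x j \<in> M k p" if "p \<ge> 1" for p
    by (rule weakly_Cauchy_differences_in_countable_cover [OF x cover [OF that]])
  \<comment> \<open>The case \<open>p = 1\<close> serves only to bound a tail of \<open>x\<close>,
    through the boundedness of \<open>M k 1\<close>.\<close>
  obtain k where k: "\<And>i. i \<ge> k \<Longrightarrow> x i - x k \<in> M k 1"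
    using tail [of 1] by auto
  obtain B where B: "\<And>y. y \<in> M k 1 \<Longrightarrow> norm y \<le> B"
    using rel [of 1 k] unfolding eps_weakly_relatively_compact_def bounded_iff by auto
  have "norm (x i) \<le> B + norm (x k)" if "i \<ge> k" for i
    using B [OF k [OF that]] norm_triangle_sub [of "x i" "x k"] by simp
  then obtain \<xi> :: "'a bidual" where \<xi>: "\<And>f. (\<lambda>n. blinfun_apply f (x n)) \<longlonglongrightarrow> blinfun_apply \<xi> f"
    using weakly_Cauchy_bidual_limit [OF x] by blast
  have near: "\<exists>y. norm (?J y - \<xi>) \<le> 1 / real p" if p: "p \<ge> 1" for p
  proof -
    obtain k where k: "\<And>i. i \<ge> k \<Longrightarrow> x i - x k \<in> M k p"
      using tail [OF p] by auto
    let ?C = "weak_star_topology closure_of (?J ` M k p)"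
    \<comment> \<open>Fixing the second index at \<open>k\<close> turns the differences into a
      translate of \<open>x\<close>, whose weak* limit is the translated
      \<open>\<xi>\<close>.\<close>
    have "limitin weak_star_topology (\<lambda>i. ?J (x i - x k)) (\<xi> - ?J (x k)) sequentially"
      using tendsto_diff [OF \<xi> tendsto_const]
      by (simp add: limitin_strong_operator_topology_iff blinfun.bilinear_simps)
    moreover have "\<forall>\<^sub>F i in sequentially. ?J (x i - x k) \<in> ?C"
      using k closure_of_subset [of "?J ` M k p" weak_star_topology]
      by (intro eventually_sequentiallyI [of k]) (auto simp: strong_operator_topology_topspace)
    ultimately have "\<xi> - ?J (x k) \<in> ?C"
      by (rule limitin_closedin [OF _ closedin_closure_of _ sequentially_bot])
    then obtain y u where yu: "\<xi> - ?J (x k) = ?J y + (1 / real p) *\<^sub>R u" "norm u \<le> 1"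
      using rel [OF p, of k] unfolding eps_weakly_relatively_compact_def by auto
    \<comment> \<open>The translation is undone inside the space, so \<open>y + x k\<close> is the
      required approximation.\<close>
    have "?J (y + x k) - \<xi> = - ((1 / real p) *\<^sub>R u)"
      using yu(1) linear_add [OF bounded_linear.linear [OF bounded_linear_canonical_embedding], of y "x k"]
      by (simp add: algebra_simps)
    then have "norm (?J (y + x k) - \<xi>) \<le> 1 / real p"
      using yu(2) p by (simp add: divide_right_mono)
    then show ?thesis
      by blast
  qed
  have "\<xi> \<in> closure (range ?J)"
    unfolding closure_approachable
  proof (intro allI impI)
    fix e :: real
    assume "e > 0"
    \<comment> \<open>\<open>Suc p\<close> respects the condition \<open>p \<ge> 1\<close> in
      \<open>near\<close>.\<close>
    then obtain p where "inverse (real (Suc p)) < e"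
      using reals_Archimedean by blast
    moreover obtain y where "norm (?J y - \<xi>) \<le> inverse (real (Suc p))"
      using near [of "Suc p"] by (auto simp: inverse_eq_divide)
    ultimately have "norm (?J y - \<xi>) < e"
      by simp
    then show "\<exists>z\<in>range ?J. dist z \<xi> < e"
      by (auto simp: dist_norm)
  qed
  then obtain l where "\<xi> = ?J l"
    using closure_closed [OF closed_range_canonical_embedding] by auto
  then have "limitin weak_topology x l sequentially"
    using \<xi> by (simp add: limitin_weak_topology_iff)
  then show "\<exists>l. limitin weak_topology x l sequentially" ..
qed

end
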